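(* Let $A$ be an $n\times n$ M-matrix and let $U\in\mathcal{U}(A)$, where $\mathcal{U}(A)$ is the set of matrices defined in the context. Let $S_1,\dots,S_m$ be the singular classes of $A$. Then for each $i\in\{1,\dots,m\}$ and $j\in\{1,\dots,n\}$, if $j$ has access to $S_i$ in $\mathcal{G}(A)$, then $j$ has access to some vertex $q\in S_i$ in $\mathcal{G}(U)$.
   Context: All matrices are real $n\times n$, and $\langle n\rangle=\{1,\dots,n\}$. An M-matrix is a matrix of the form $\alpha I-P$ with $P$ entrywise nonnegative and $\alpha\in\mathbb{R}$ at least the spectral radius of $P$ (so M-matrices may be singular). The directed graph $\mathcal{G}(X)$ of $X=[x_{ij}]$ has vertex set $\langle n\rangle$ and edges $\{(i,j): x_{ij}\neq 0\}$. A vertex $j$ has access to $k$ if there is a directed path from $j$ to $k$; the empty path is allowed, so every vertex has access to itself. The classes of $X$ are the equivalence classes of the relation "$j$ has access to $k$ and $k$ has access to $j$" in $\mathcal{G}(X)$. For $J\subseteq\langle n\rangle$, $X_{JJ}$ is the principal submatrix with rows and columns indexed by $J$. A class $J$ of $X$ is a singular class of $X$ if $X_{JJ}$ is singular. A vertex has access to a class if it has access to some vertex of it. A matrix $X$ is class nonsingular for $A$ if $X_{KK}$ is nonsingular for every class $K$ of $A$ ($K$ need not be a class of $X$). Let $\mathcal{N}_A=\{X : X\ge 0 \text{ entrywise and } X \text{ is class nonsingular for } A\}$ and $$\mathcal{U}(A)=\{BA : B\in\mathcal{N}_A,\ BA \text{ is an M-matrix}\}.$$ *)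

theory Defs
  imports
    "Jordan_Normal_Form.Spectral_Radius"
    "Jordan_Normal_Form.DL_Submatrix"
begin

text \<open>
  Matrices are those of \<^theory>\<open>Jordan_Normal_Form.Matrix\<close>, so the index set
  $\{1,\dots,n\}$ becomes \<open>{0..<n}\<close>. The order on matrices in that theory is entrywise.
\<close>

definition m_matrix :: "real mat \<Rightarrow> bool" where
  "m_matrix A \<longleftrightarrow> (\<exists>n P \<alpha>. P \<in> carrier_mat n n \<and> 0\<^sub>m n n \<le> P \<and>
     spectral_radius (map_mat complex_of_real P) \<le> \<alpha> \<and>
     A = \<alpha> \<cdot>\<^sub>m 1\<^sub>m n - P)"

definition graph_edges :: "real mat \<Rightarrow> (nat \<times> nat) set" where
  "graph_edges X = {(i, j). i < dim_row X \<and> j < dim_col X \<and> X $$ (i, j) \<noteq> 0}"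

definition has_access :: "real mat \<Rightarrow> nat \<Rightarrow> nat \<Rightarrow> bool" where
  "has_access X j k \<longleftrightarrow> j < dim_row X \<and> k < dim_row X \<and> (j, k) \<in> (graph_edges X)\<^sup>*"

definition has_access_to_set :: "real mat \<Rightarrow> nat \<Rightarrow> nat set \<Rightarrow> bool" where
  "has_access_to_set X j J \<longleftrightarrow> (\<exists>q\<in>J. has_access X j q)"

definition access_classes :: "real mat \<Rightarrow> nat set set" where
  "access_classes X = {0..<dim_row X} // {(j, k). has_access X j k \<and> has_access X k j}"

definition singular_classes :: "real mat \<Rightarrow> nat set set" where
  "singular_classes X = {J \<in> access_classes X. \<not> invertible_mat (submatrix X J J)}"

definition class_nonsingular :: "real mat \<Rightarrow> real mat \<Rightarrow> bool" where
  "class_nonsingular A X \<longleftrightarrow> (\<forall>K\<in>access_classes A. invertible_mat (submatrix X K K))"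

definition N_set :: "real mat \<Rightarrow> real mat set" where
  "N_set A = {X \<in> carrier_mat (dim_row A) (dim_row A).
     0\<^sub>m (dim_row A) (dim_row A) \<le> X \<and> class_nonsingular A X}"

definition U_set :: "real mat \<Rightarrow> real mat set" where
  "U_set A = {B * A | B. B \<in> N_set A \<and> m_matrix (B * A)}"

end

theory Submission
  imports Defs
begin

text \<open>
  Write \<open>L\<close> for the set of vertices with access to the singular class \<open>S\<close> in the graph of \<open>A\<close>.
  The proof rests on a test vector \<open>x \<ge> 0\<close> with support exactly \<open>L\<close> such that \<open>A x \<le> 0\<close>, with strict
  inequality at every vertex of \<open>L - S\<close> (\<open>singular_class_test_vector\<close>).

  To build it, take \<open>v \<noteq> 0\<close> in the kernel of the principal submatrix on \<open>S\<close>. As the off-diagonal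
  entries of \<open>A\<close> are nonpositive, \<open>\<bar>v\<bar>\<close>, extended by zero, satisfies \<open>A \<bar>v\<bar> \<le> 0\<close>. Some power \<open>Q\<close> of
  \<open>c I - A\<close>, with \<open>c\<close> large, is nonnegative, commutes with \<open>A\<close>, and has a positive entry at \<open>(i, j)\<close>
  exactly when \<open>i\<close> has access to \<open>j\<close> (\<open>access_pattern_matrix\<close>). Hence \<open>Q\<close> maps a
  vector \<open>z \<ge> 0\<close> with \<open>A z \<le> 0\<close> to another such vector, supported on all vertices with access to the
  support of \<open>z\<close>. Restricting \<open>Q \<bar>v\<bar>\<close>
  to \<open>S\<close> gives \<open>y\<close> with support exactly \<open>S\<close> and \<open>A y \<le> 0\<close>, strictly so at every vertex
  outside \<open>S\<close> with an edge into \<open>S\<close>; then \<open>x = Q y\<close> is as required.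

  Let \<open>U = B A\<close>. Then \<open>U x = B (A x) \<le> 0\<close>. If \<open>i \<in> L - S\<close> has class \<open>K\<close> in \<open>A\<close>, then \<open>K \<subseteq> L - S\<close>, and
  row \<open>i\<close> of \<open>B\<close> has a positive entry in a column of \<open>K\<close> because the principal submatrix of
  \<open>B\<close> on \<open>K\<close> is nonsingular. Hence \<open>U x\<close> is negative on \<open>L - S\<close>. Suppose now that some vertex of \<open>L\<close>
  has no access to \<open>S\<close> in \<open>U\<close>, and let \<open>x'\<close> be the restriction of \<open>x\<close> to the set of all vertices without such
  access. No edge of \<open>U\<close> leaves this set, so \<open>U x'\<close> agrees with \<open>U x\<close> there and is negative on the support
  of \<open>x'\<close>. With \<open>U = \<alpha> I - P\<close> this says \<open>P x' > \<alpha> x'\<close> on the support of \<open>x'\<close>, which forces the spectral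
  radius of \<open>P\<close> to exceed \<open>\<alpha>\<close> (\<open>spectral_radius_greaterI\<close>): a contradiction.
\<close>

section \<open>Matrices acting on functions\<close>

text \<open>
  The product of a matrix with a vector. Vectors are functions on \<open>nat\<close>, of which only the
  values at column indices count, so that restricting a vector to a set of indices is a conditional.
\<close>

definition mat_app :: "real mat \<Rightarrow> (nat \<Rightarrow> real) \<Rightarrow> nat \<Rightarrow> real" where
  "mat_app M x i = (\<Sum>j<dim_col M. M $$ (i, j) * x j)"

lemma index_mult_mat_sum:
  assumes "M \<in> carrier_mat n n" "N \<in> carrier_mat n n" "i < n" "j < n"
  shows "(M * N) $$ (i, j) = (\<Sum>k<n. M $$ (i, k) * N $$ (k, j))"
  using assms by (simp add: scalar_prod_def lessThan_atLeast0)

lemma mat_app_mult: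
  assumes M: "M \<in> carrier_mat n n" and N: "N \<in> carrier_mat n n" and i: "i < n"
  shows "mat_app (M * N) x i = mat_app M (mat_app N x) i"
proof -
  have "mat_app (M * N) x i = (\<Sum>j<n. \<Sum>k<n. M $$ (i, k) * N $$ (k, j) * x j)"
    using N by (simp add: mat_app_def index_mult_mat_sum[OF M N i] sum_distrib_right)
  also have "\<dots> = (\<Sum>k<n. \<Sum>j<n. M $$ (i, k) * N $$ (k, j) * x j)"
    by (rule sum.swap)
  also have "\<dots> = mat_app M (mat_app N x) i"
    using M N by (simp add: mat_app_def sum_distrib_left mult.assoc)
  finally show ?thesis .
qed

lemma mat_app_nonneg:
  assumes "M \<in> carrier_mat n n" "\<And>j. j < n \<Longrightarrow> M $$ (i, j) \<ge> 0" "\<And>j. j < n \<Longrightarrow> x j \<ge> 0"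
  shows "mat_app M x i \<ge> 0"
  using assms by (auto simp: mat_app_def intro!: sum_nonneg)

lemma mat_app_mono:
  assumes "M \<in> carrier_mat n n" "\<And>j. j < n \<Longrightarrow> M $$ (i, j) \<ge> 0" "\<And>j. j < n \<Longrightarrow> x j \<le> y j"
  shows "mat_app M x i \<le> mat_app M y i"
  using assms by (auto simp: mat_app_def intro!: sum_mono mult_left_mono)

lemma mat_app_nonpos:
  assumes "M \<in> carrier_mat n n" "\<And>j. j < n \<Longrightarrow> M $$ (i, j) \<ge> 0" "\<And>j. j < n \<Longrightarrow> x j \<le> 0"
  shows "mat_app M x i \<le> 0"
  using assms by (auto simp: mat_app_def intro!: sum_nonpos mult_nonneg_nonpos)

lemma mat_app_neg:
  assumes M: "M \<in> carrier_mat n n" and nn: "\<And>j. j < n \<Longrightarrow> M $$ (i, j) \<ge> 0"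
    and x: "\<And>j. j < n \<Longrightarrow> x j \<le> 0" and k: "k < n" "M $$ (i, k) > 0" "x k < 0"
  shows "mat_app M x i < 0"
proof -
  have "0 < (\<Sum>j<n. - (M $$ (i, j) * x j))"
    by (rule sum_pos2[where i = k])
      (use nn x k in \<open>auto simp: mult_pos_neg mult_nonneg_nonpos\<close>)
  then show ?thesis
    using M by (simp add: mat_app_def sum_negf)
qed

lemma mat_app_pos_iff:
  assumes M: "M \<in> carrier_mat n n" and nn: "\<And>j. j < n \<Longrightarrow> M $$ (i, j) \<ge> 0"
    and x: "\<And>j. j < n \<Longrightarrow> x j \<ge> 0"
  shows "mat_app M x i > 0 \<longleftrightarrow> (\<exists>k<n. M $$ (i, k) > 0 \<and> x k > 0)"
proof -
  have "mat_app M x i = 0 \<longleftrightarrow> (\<forall>k<n. M $$ (i, k) * x k = 0)"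
    using M nn x by (subst mat_app_def, subst sum_nonneg_eq_0_iff) auto
  moreover have "mat_app M x i \<ge> 0"
    by (rule mat_app_nonneg[OF M nn x])
  ultimately show ?thesis
    using nn x by (metis less_eq_real_def mult_eq_0_iff order_less_irrefl)
qed

lemma mat_app_scale: "mat_app M (\<lambda>j. c * x j) i = c * mat_app M x i"
  by (simp add: mat_app_def sum_distrib_left mult_ac)

lemma mat_app_one: "i < n \<Longrightarrow> mat_app (1\<^sub>m n) x i = x i"
  by (simp add: mat_app_def if_distrib if_distribR cong: if_cong)

lemma pow_mat_nonneg:
  fixes M :: "real mat"
  assumes M: "M \<in> carrier_mat n n" and nn: "\<And>i j. i < n \<Longrightarrow> j < n \<Longrightarrow> M $$ (i, j) \<ge> 0"
    and "i < n" "j < n"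
  shows "(M ^\<^sub>m k) $$ (i, j) \<ge> 0"
  using \<open>j < n\<close>
proof (induction k arbitrary: j)
  case 0
  then show ?case using M \<open>i < n\<close> by simp
next
  case (Suc k)
  then have "(M ^\<^sub>m Suc k) $$ (i, j) = (\<Sum>l<n. (M ^\<^sub>m k) $$ (i, l) * M $$ (l, j))"
    using index_mult_mat_sum[OF pow_carrier_mat[OF M] M \<open>i < n\<close>] by simp
  then show ?case
    using Suc nn by (auto intro!: sum_nonneg)
qed

section \<open>A lower bound for the spectral radius of a nonnegative matrix\<close>

lemma spectral_radius_scale_less_one:
  fixes M :: "complex mat" and \<gamma> :: real
  assumes M: "M \<in> carrier_mat n n" and n: "n > 0" and \<gamma>: "spectral_radius M < \<gamma>" "\<gamma> > 0"
  shows "spectral_radius (complex_of_real (1 / \<gamma>) \<cdot>\<^sub>m M) < 1"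
proof -
  let ?C = "complex_of_real (1 / \<gamma>) \<cdot>\<^sub>m M"
  have C: "?C \<in> carrier_mat n n" using M by simp
  from spectral_radius_mem_max(1)[OF C n] obtain e where
    e: "eigenvalue ?C e" "spectral_radius ?C = norm e"
    by (auto simp: spectrum_def)
  then obtain v where v: "v \<in> carrier_vec n" "v \<noteq> 0\<^sub>v n" "?C *\<^sub>v v = e \<cdot>\<^sub>v v"
    using M by (auto simp: eigenvalue_def eigenvector_def)
  have "M *\<^sub>v v = (complex_of_real \<gamma> * e) \<cdot>\<^sub>v v"
  proof (rule eq_vecI)
    fix i assume "i < dim_vec ((complex_of_real \<gamma> * e) \<cdot>\<^sub>v v)"
    then have i: "i < n" using v by simp
    have "(?C *\<^sub>v v) $ i = complex_of_real (1 / \<gamma>) * (M *\<^sub>v v) $ i"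
      using M v(1) i by (simp add: scalar_prod_def sum_divide_distrib)
    moreover have "(?C *\<^sub>v v) $ i = e * v $ i"
      using v i by simp
    ultimately show "(M *\<^sub>v v) $ i = ((complex_of_real \<gamma> * e) \<cdot>\<^sub>v v) $ i"
      using v i \<gamma>(2) by (simp add: field_simps)
  qed (use M v in auto)
  then have "eigenvalue M (complex_of_real \<gamma> * e)"
    using M v by (auto simp: eigenvalue_def eigenvector_def)
  then have "norm (complex_of_real \<gamma> * e) \<le> spectral_radius M"
    using spectral_radius_mem_max(2)[OF M n] by (auto simp: spectrum_def)
  then have "\<gamma> * norm e \<le> spectral_radius M"
    using \<gamma>(2) by (simp add: norm_mult)
  with \<gamma> have "norm e < 1"
    using mult_left_mono[of 1 "norm e" \<gamma>] by linarith
  then show ?thesis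
    using e(2) by simp
qed

text \<open>
  The Collatz--Wielandt lower bound. If \<open>\<beta>\<close> exceeded the spectral radius, then the powers of
  \<open>P / \<gamma>\<close>, for some \<open>\<gamma>\<close> strictly in between, would be bounded, although they stretch \<open>x\<close> by at
  least the factors \<open>(\<beta> / \<gamma>) ^ k\<close>.
\<close>

lemma spectral_radius_geI:
  fixes P :: "real mat" and x :: "nat \<Rightarrow> real"
  assumes P: "P \<in> carrier_mat n n" and nn: "\<And>i j. i < n \<Longrightarrow> j < n \<Longrightarrow> P $$ (i, j) \<ge> 0"
    and x: "\<And>i. i < n \<Longrightarrow> x i \<ge> 0" and m: "m < n" "x m > 0"
    and le: "\<And>i. i < n \<Longrightarrow> \<beta> * x i \<le> mat_app P x i"
  shows "\<beta> \<le> spectral_radius (map_mat complex_of_real P)"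
proof (rule ccontr)
  let ?M = "map_mat complex_of_real P"
  assume "\<not> ?thesis"
  then obtain \<gamma> where \<gamma>: "spectral_radius ?M < \<gamma>" "\<gamma> < \<beta>"
    by (meson dense not_le)
  have M: "?M \<in> carrier_mat n n" using P by simp
  have n: "n > 0" using m by simp
  have "spectral_radius ?M \<ge> 0"
    using spectral_radius_mem_max(1)[OF M n] by auto
  with \<gamma> have \<gamma>0: "\<gamma> > 0" by simp
  define R where "R = (1 / \<gamma>) \<cdot>\<^sub>m P"
  have R: "R \<in> carrier_mat n n" using P by (simp add: R_def)
  have R_hom: "map_mat complex_of_real R = complex_of_real (1 / \<gamma>) \<cdot>\<^sub>m ?M"
    using P by (intro eq_matI) (auto simp: R_def)
  obtain c where c: "\<And>k. norm_bound (map_mat complex_of_real R ^\<^sub>m k) c"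
    using spectral_radius_jnf_norm_bound_less_1_upper_triangular[of "map_mat complex_of_real R" n]
      spectral_radius_scale_less_one[OF M n \<gamma>(1) \<gamma>0, folded R_hom] R by auto
  have R_nn: "R $$ (i, j) \<ge> 0" if "i < n" "j < n" for i j
    using that nn P \<gamma>0 by (simp add: R_def)
  have R_app: "mat_app R y i = mat_app P y i / \<gamma>" if "i < n" for y i
    using P that by (simp add: R_def mat_app_def sum_divide_distrib)
  have R_pow: "R ^\<^sub>m k \<in> carrier_mat n n" for k using R by simp
  have pow_nn: "(R ^\<^sub>m k) $$ (i, j) \<ge> 0" if "i < n" "j < n" for i j k
    by (rule pow_mat_nonneg[OF R R_nn that])
  have lower: "(\<beta> / \<gamma>) ^ k * x i \<le> mat_app (R ^\<^sub>m k) x i" if "i < n" for k i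
  proof (induction k)
    case 0
    then show ?case
      using R that by (simp add: mat_app_one)
  next
    case (Suc k)
    have "(\<beta> / \<gamma>) ^ Suc k * x i \<le> (\<beta> / \<gamma>) * mat_app (R ^\<^sub>m k) x i"
      using Suc \<gamma> \<gamma>0 by (simp add: mult.assoc divide_right_mono mult_left_mono)
    also have "\<dots> = mat_app (R ^\<^sub>m k) (\<lambda>j. \<beta> / \<gamma> * x j) i"
      by (simp only: mat_app_scale)
    also have "\<dots> \<le> mat_app (R ^\<^sub>m k) (mat_app R x) i"
      by (rule mat_app_mono[OF R_pow pow_nn[OF that]])
        (use le \<gamma>0 in \<open>auto simp: R_app divide_right_mono\<close>)
    also have "\<dots> = mat_app (R ^\<^sub>m Suc k) x i"
      using mat_app_mult[OF R_pow R that] by simp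
    finally show ?case .
  qed
  have upper: "mat_app (R ^\<^sub>m k) x m \<le> c * (\<Sum>j<n. x j)" for k
  proof -
    have "(R ^\<^sub>m k) $$ (m, j) \<le> c" if "j < n" for j
    proof -
      have "norm ((map_mat complex_of_real R ^\<^sub>m k) $$ (m, j)) \<le> c"
        using c[of k] R m that by (auto simp: norm_bound_def)
      moreover have "map_mat complex_of_real R ^\<^sub>m k = map_mat complex_of_real (R ^\<^sub>m k)"
        by (rule of_real_hom.mat_hom_pow[OF R, symmetric])
      ultimately show ?thesis
        using R m that by simp
    qed
    then show ?thesis
      using R x by (auto simp: mat_app_def sum_distrib_left intro!: sum_mono mult_right_mono)
  qed
  obtain k where "c * (\<Sum>j<n. x j) / x m < (\<beta> / \<gamma>) ^ k"
    using real_arch_pow[of "\<beta> / \<gamma>"] \<gamma> \<gamma>0 by auto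
  then have "c * (\<Sum>j<n. x j) < (\<beta> / \<gamma>) ^ k * x m"
    using m by (simp add: field_simps)
  with lower[OF m(1), of k] upper[of k] show False by simp
qed

lemma spectral_radius_greaterI:
  fixes P :: "real mat" and x :: "nat \<Rightarrow> real"
  assumes P: "P \<in> carrier_mat n n" and nn: "\<And>i j. i < n \<Longrightarrow> j < n \<Longrightarrow> P $$ (i, j) \<ge> 0"
    and x: "\<And>i. i < n \<Longrightarrow> x i \<ge> 0" and m: "m < n" "x m > 0"
    and less: "\<And>i. i < n \<Longrightarrow> x i > 0 \<Longrightarrow> \<alpha> * x i < mat_app P x i"
  shows "\<alpha> < spectral_radius (map_mat complex_of_real P)"
proof -
  define I where "I = {i. i < n \<and> x i > 0}"
  define \<beta> where "\<beta> = Min ((\<lambda>i. mat_app P x i / x i) ` I)"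
  have I: "finite I" "I \<noteq> {}" using m by (auto simp: I_def)
  have "\<alpha> < mat_app P x i / x i" if "i \<in> I" for i
    using that less[of i] by (simp add: I_def field_simps)
  then have "\<alpha> < \<beta>"
    using I by (simp add: \<beta>_def)
  also have "\<beta> \<le> spectral_radius (map_mat complex_of_real P)"
  proof (rule spectral_radius_geI[where x = x, OF P nn x m])
    fix i assume i: "i < n"
    show "\<beta> * x i \<le> mat_app P x i"
    proof (cases "x i > 0")
      case True
      then have "\<beta> \<le> mat_app P x i / x i"
        using I i by (auto simp: \<beta>_def I_def)
      then show ?thesis
        using True by (simp add: field_simps)
    next
      case False
      then have "x i = 0" using x[OF i] by simp
      then show ?thesis
        using mat_app_nonneg[OF P nn[OF i] x] by simp
    qed
  qed
  finally show ?thesis .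
qed

section \<open>Access relations and classes\<close>

lemma has_access_refl: "i < dim_row X \<Longrightarrow> has_access X i i"
  by (simp add: has_access_def)

lemma has_access_trans: "has_access X i j \<Longrightarrow> has_access X j k \<Longrightarrow> has_access X i k"
  by (auto simp: has_access_def)

lemma has_access_edge:
  assumes "X \<in> carrier_mat n n" "i < n" "j < n" "X $$ (i, j) \<noteq> 0"
  shows "has_access X i j"
  using assms by (auto simp: has_access_def graph_edges_def)

lemma has_access_less:
  assumes "X \<in> carrier_mat n n" "has_access X i j"
  shows "i < n" "j < n"
  using assms by (auto simp: has_access_def)

lemma access_class_ex:
  assumes "i < dim_row X"
  shows "\<exists>K\<in>access_classes X. i \<in> K"
  using assms unfolding access_classes_def quotient_def
  by (intro bexI[of _ "{(j, k). has_access X j k \<and> has_access X k j} `` {i}"])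
    (auto simp: has_access_refl)

lemma access_class_less: "K \<in> access_classes X \<Longrightarrow> i \<in> K \<Longrightarrow> i < dim_row X"
  by (auto simp: access_classes_def quotient_def has_access_def)

lemma access_class_access: "K \<in> access_classes X \<Longrightarrow> i \<in> K \<Longrightarrow> j \<in> K \<Longrightarrow> has_access X i j"
  by (auto simp: access_classes_def quotient_def intro: has_access_trans)

lemma access_class_closed:
  assumes "K \<in> access_classes X" "i \<in> K" "has_access X i j" "has_access X j i"
  shows "j \<in> K"
  using assms by (auto simp: access_classes_def quotient_def intro: has_access_trans)

text \<open>
  A power of \<open>c I - A\<close> with \<open>c\<close> so large that the diagonal is positive. The positive diagonal
  makes the positivity patterns of the powers increase, so one exponent serves all pairs of vertices.
\<close>

lemma access_pattern_matrix:
  fixes A :: "real mat"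
  assumes A: "A \<in> carrier_mat n n"
    and off: "\<And>i j. i < n \<Longrightarrow> j < n \<Longrightarrow> i \<noteq> j \<Longrightarrow> A $$ (i, j) \<le> 0"
  obtains Q where "Q \<in> carrier_mat n n" "Q * A = A * Q"
    "\<And>i j. i < n \<Longrightarrow> j < n \<Longrightarrow> Q $$ (i, j) \<ge> 0"
    "\<And>i j. i < n \<Longrightarrow> j < n \<Longrightarrow> Q $$ (i, j) > 0 \<longleftrightarrow> has_access A i j"
proof -
  define c where "c = 1 + (\<Sum>i<n. \<bar>A $$ (i, i)\<bar>)"
  define R where "R = c \<cdot>\<^sub>m 1\<^sub>m n - A"
  have R: "R \<in> carrier_mat n n" and Rk: "\<And>k. R ^\<^sub>m k \<in> carrier_mat n n"
    using A by (auto simp: R_def)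
  have c: "A $$ (i, i) < c" if "i < n" for i
  proof -
    have "\<bar>A $$ (i, i)\<bar> \<le> (\<Sum>i<n. \<bar>A $$ (i, i)\<bar>)"
      using that by (intro member_le_sum) auto
    then show ?thesis by (simp add: c_def)
  qed
  have R_index: "R $$ (i, j) = (if i = j then c - A $$ (i, i) else - A $$ (i, j))"
    if "i < n" "j < n" for i j
    using A that by (auto simp: R_def)
  have R_nn: "R $$ (i, j) \<ge> 0" if "i < n" "j < n" for i j
    using that off c[of i] by (auto simp: R_index)
  have R_diag: "R $$ (i, i) > 0" if "i < n" for i
    using that c[of i] by (simp add: R_index)
  have pow_nn: "(R ^\<^sub>m k) $$ (i, j) \<ge> 0" if "i < n" "j < n" for i j k
    by (rule pow_mat_nonneg[OF R R_nn that])
  have R_access: "has_access A i j" if "i < n" "j < n" "R $$ (i, j) > 0" for i j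
  proof (cases "i = j")
    case True
    then show ?thesis using A that by (simp add: has_access_refl)
  next
    case False
    then show ?thesis using A that by (auto simp: R_index intro: has_access_edge)
  qed
  have pow_step: "(R ^\<^sub>m Suc k) $$ (i, j) > 0 \<longleftrightarrow> (\<exists>l<n. (R ^\<^sub>m k) $$ (i, l) > 0 \<and> R $$ (l, j) > 0)"
    if "i < n" "j < n" for i j k
  proof -
    have "(R ^\<^sub>m Suc k) $$ (i, j) = mat_app (R ^\<^sub>m k) (\<lambda>l. R $$ (l, j)) i"
      using index_mult_mat_sum[OF Rk R that] R by (simp add: mat_app_def)
    then show ?thesis
      using mat_app_pos_iff[OF Rk pow_nn R_nn] that by simp
  qed
  have pos_access: "has_access A i j" if "i < n" "j < n" "(R ^\<^sub>m k) $$ (i, j) > 0" for i j k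
    using that(2,3)
  proof (induction k arbitrary: j)
    case 0
    then show ?case
      using A R that(1) by (auto simp: has_access_refl split: if_splits)
  next
    case (Suc k)
    then show ?case
      using pow_step that(1) R_access by (meson has_access_trans)
  qed
  have mono: "(R ^\<^sub>m k') $$ (i, j) > 0" if "(R ^\<^sub>m k) $$ (i, j) > 0" "k \<le> k'" "i < n" "j < n" for i j k k'
    using that(2) by (induction rule: dec_induct) (use that pow_step R_diag in blast)+
  have access_pos: "\<exists>k. (R ^\<^sub>m k) $$ (i, j) > 0" if "has_access A i j" for i j
  proof -
    have i: "i < n" using has_access_less[OF A that] by simp
    have "(i, j) \<in> (graph_edges A)\<^sup>*" using that by (simp add: has_access_def)
    then have "j < n \<and> (\<exists>k. (R ^\<^sub>m k) $$ (i, j) > 0)"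
    proof (induction rule: rtrancl_induct)
      case base
      have "(R ^\<^sub>m 0) $$ (i, i) > 0" using R i by simp
      with i show ?case by blast
    next
      case (step l j)
      then have l: "l < n" "j < n" "A $$ (l, j) \<noteq> 0"
        using A by (auto simp: graph_edges_def)
      have "R $$ (l, j) > 0"
        using l off[of l j] R_diag by (cases "l = j") (auto simp: R_index less_le)
      with l step.IH pow_step[OF i l(2)] show ?case by blast
    qed
    then show ?thesis by blast
  qed
  have "\<forall>\<^sub>F k in sequentially. \<forall>i\<in>{..<n}. \<forall>j\<in>{..<n}. has_access A i j \<longrightarrow> (R ^\<^sub>m k) $$ (i, j) > 0"
  proof (intro eventually_ball_finite ballI finite_lessThan)
    fix i j assume "i \<in> {..<n}" "j \<in> {..<n}"
    then show "\<forall>\<^sub>F k in sequentially. has_access A i j \<longrightarrow> (R ^\<^sub>m k) $$ (i, j) > 0"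
      using access_pos[of i j] mono[of _ i j] unfolding eventually_sequentially by blast
  qed
  then obtain N where N: "\<And>i j. i < n \<Longrightarrow> j < n \<Longrightarrow> has_access A i j \<Longrightarrow> (R ^\<^sub>m N) $$ (i, j) > 0"
    unfolding eventually_sequentially by blast
  have comm: "R * A = A * R"
    using A by (simp add: R_def minus_mult_distrib_mat[of _ n n _ _ n] mult_minus_distrib_mat[of _ n n _ n]
        mult_smult_assoc_mat[of _ n n _ n] mult_smult_distrib[of _ n n _ n])
  have "R ^\<^sub>m k * A = A * R ^\<^sub>m k" for k
  proof (induction k)
    case 0
    then show ?case using A R by simp
  next
    case (Suc k)
    have "R ^\<^sub>m Suc k * A = R ^\<^sub>m k * (A * R)"
      using assoc_mult_mat[OF Rk R A] by (simp add: comm)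
    also have "\<dots> = A * R ^\<^sub>m k * R"
      using assoc_mult_mat[OF Rk A R, of k] Suc by simp
    also have "\<dots> = A * R ^\<^sub>m Suc k"
      using assoc_mult_mat[OF A Rk R] by simp
    finally show ?case .
  qed
  then show ?thesis
    using that[of "R ^\<^sub>m N"] Rk pow_nn N pos_access by blast
qed

section \<open>Principal submatrices\<close>

lemma bij_betw_pick:
  assumes "K \<subseteq> {..<n}"
  shows "bij_betw (pick K) {..<card K} K"
proof (rule bij_betw_imageI)
  show "inj_on (pick K) {..<card K}"
    by (rule inj_onI) (metis card_pick_le lessThan_iff)
  have fin: "finite K" using assms finite_subset by blast
  have "i \<in> pick K ` {..<card K}" if "i \<in> K" for i
  proof (rule image_eqI)
    show "i = pick K (card {a \<in> K. a < i})" by (simp add: pick_card_in_set that)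
    show "card {a \<in> K. a < i} \<in> {..<card K}"
      using that fin by (auto intro!: psubset_card_mono)
  qed
  then show "pick K ` {..<card K} = K"
    by (auto simp: pick_in_set_le)
qed

lemma submatrix_principal:
  assumes "M \<in> carrier_mat n n" "K \<subseteq> {..<n}"
  shows "submatrix M K K \<in> carrier_mat (card K) (card K)"
    and "a < card K \<Longrightarrow> b < card K \<Longrightarrow> submatrix M K K $$ (a, b) = M $$ (pick K a, pick K b)"
proof -
  have "{i. i < n \<and> i \<in> K} = K" using assms(2) by auto
  then show "submatrix M K K \<in> carrier_mat (card K) (card K)"
    and "a < card K \<Longrightarrow> b < card K \<Longrightarrow> submatrix M K K $$ (a, b) = M $$ (pick K a, pick K b)"
    using assms(1) by (auto simp: submatrix_def)
qed

lemma invertible_mat_if_det_nonzero: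
  fixes M :: "real mat"
  assumes M: "M \<in> carrier_mat k k" and "det M \<noteq> 0"
  shows "invertible_mat M"
proof -
  have "M \<in> Units (ring_mat TYPE(real) k ())"
    by (rule det_non_zero_imp_unit[OF assms])
  then obtain N where "N \<in> carrier_mat k k" "N * M = 1\<^sub>m k" "M * N = 1\<^sub>m k"
    by (auto simp: Units_def ring_mat_def)
  with M show ?thesis
    by (auto simp: invertible_mat_def inverts_mat_def intro!: exI[of _ N])
qed

lemma singular_submatrix_kernel:
  fixes M :: "real mat"
  assumes M: "M \<in> carrier_mat n n" and K: "K \<subseteq> {..<n}" and sing: "\<not> invertible_mat (submatrix M K K)"
  obtains u where "\<exists>k\<in>K. u k \<noteq> 0" "\<And>i. i \<in> K \<Longrightarrow> (\<Sum>k\<in>K. M $$ (i, k) * u k) = 0"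
proof -
  let ?S = "submatrix M K K" and ?m = "card K"
  note S = submatrix_principal[OF M K]
  note bij = bij_betw_pick[OF K]
  have "det ?S = 0"
    using invertible_mat_if_det_nonzero[OF S(1)] sing by blast
  then obtain v where v: "v \<in> carrier_vec ?m" "v \<noteq> 0\<^sub>v ?m" "?S *\<^sub>v v = 0\<^sub>v ?m"
    using det_0_iff_vec_prod_zero_field[OF S(1)] by blast
  define u where "u k = v $ (card {a \<in> K. a < k})" for k
  have u: "u (pick K b) = v $ b" if "b < ?m" for b
    using that by (simp add: u_def card_pick_le)
  show ?thesis
  proof
    obtain b where "b < ?m" "v $ b \<noteq> 0"
      using v by (metis eq_vecI carrier_vecD index_zero_vec)
    then show "\<exists>k\<in>K. u k \<noteq> 0"
      using u pick_in_set_le by metis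
  next
    fix i assume "i \<in> K"
    then obtain a where a: "a < ?m" "i = pick K a"
      using bij by (auto simp: bij_betw_def)
    have "(\<Sum>k\<in>K. M $$ (i, k) * u k) = (\<Sum>b<?m. M $$ (i, pick K b) * u (pick K b))"
      by (rule sum.reindex_bij_betw[OF bij, symmetric])
    also have "\<dots> = (?S *\<^sub>v v) $ a"
      using a(1) S(1) v(1) by (auto simp: scalar_prod_def lessThan_atLeast0 a(2) S(2) u intro!: sum.cong)
    also have "\<dots> = 0" using v a by simp
    finally show "(\<Sum>k\<in>K. M $$ (i, k) * u k) = 0" .
  qed
qed

lemma invertible_submatrix_row_nonzero:
  fixes M :: "real mat"
  assumes M: "M \<in> carrier_mat n n" and K: "K \<subseteq> {..<n}" and inv: "invertible_mat (submatrix M K K)"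
    and i: "i \<in> K"
  shows "\<exists>k\<in>K. M $$ (i, k) \<noteq> 0"
proof (rule ccontr)
  let ?S = "submatrix M K K" and ?m = "card K"
  assume zero: "\<not> ?thesis"
  note S = submatrix_principal[OF M K]
  obtain a where a: "a < ?m" "i = pick K a"
    using bij_betw_pick[OF K] i by (auto simp: bij_betw_def)
  obtain N where N: "?S * N = 1\<^sub>m ?m" "N * ?S = 1\<^sub>m (dim_row N)"
    using inv S(1) by (auto simp: invertible_mat_def inverts_mat_def)
  have "N \<in> carrier_mat ?m ?m"
    using N S(1) by (metis carrier_matD carrier_matI index_mult_mat(2,3) index_one_mat(2,3))
  then have "(?S * N) $$ (a, a) = (\<Sum>b<?m. ?S $$ (a, b) * N $$ (b, a))"
    using index_mult_mat_sum[OF S(1) _ a(1) a(1)] by simp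
  also have "\<dots> = 0"
    using zero a S(2) pick_in_set_le by (intro sum.neutral) auto
  finally show False using N a by simp
qed

section \<open>The test vector of a singular class\<close>

text \<open>
  A nonnegative vector with \<open>A y \<le> 0\<close> and support exactly the singular class: the entrywise
  absolute value of a kernel vector of the principal submatrix on \<open>S\<close>, spread over all of \<open>S\<close> by
  an access pattern matrix and cut off outside \<open>S\<close>. The cut-off does not change \<open>A y\<close> on \<open>S\<close>, since no
  vertex outside \<open>S\<close> both is reached by an edge from \<open>S\<close> and has access to \<open>S\<close>.
\<close>

lemma singular_class_supported_vector:
  fixes A :: "real mat"
  assumes A: "A \<in> carrier_mat n n"
    and off: "\<And>i j. i < n \<Longrightarrow> j < n \<Longrightarrow> i \<noteq> j \<Longrightarrow> A $$ (i, j) \<le> 0"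
    and S: "S \<in> singular_classes A"
  obtains y where "\<And>i. i \<in> S \<Longrightarrow> y i > 0" "\<And>i. i \<notin> S \<Longrightarrow> y i = 0" "\<And>i. i < n \<Longrightarrow> mat_app A y i \<le> 0"
proof -
  have cl: "S \<in> access_classes A" and sing: "\<not> invertible_mat (submatrix A S S)"
    using S by (auto simp: singular_classes_def)
  have S_sub: "S \<subseteq> {..<n}"
    using access_class_less[OF cl] A by auto
  obtain u where u: "\<exists>k\<in>S. u k \<noteq> 0" "\<And>i. i \<in> S \<Longrightarrow> (\<Sum>k\<in>S. A $$ (i, k) * u k) = 0"
    using singular_submatrix_kernel[OF A S_sub sing] by blast
  have restrict: "mat_app A (\<lambda>k. if k \<in> S then w k else 0) i = (\<Sum>k\<in>S. A $$ (i, k) * w k)" for w i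
  proof -
    have "(\<Sum>k\<in>S. A $$ (i, k) * w k) = (\<Sum>k<n. A $$ (i, k) * (if k \<in> S then w k else 0))"
      using S_sub by (intro sum.mono_neutral_cong_left) auto
    then show ?thesis using A by (simp add: mat_app_def)
  qed
  define w where "w k = (if k \<in> S then \<bar>u k\<bar> else 0)" for k
  have w_nn: "w k \<ge> 0" for k by (simp add: w_def)
  have outside: "(\<Sum>k\<in>S. A $$ (i, k) * z k) \<le> 0" if "i < n" "i \<notin> S" "\<And>k. k \<in> S \<Longrightarrow> z k \<ge> 0" for i z
  proof (rule sum_nonpos)
    fix k assume "k \<in> S"
    then have "k < n" "i \<noteq> k" using S_sub that by auto
    then show "A $$ (i, k) * z k \<le> 0"
      using off that \<open>k \<in> S\<close> by (simp add: mult_nonpos_nonneg)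
  qed
  have Aw: "mat_app A w i \<le> 0" if i: "i < n" for i
  proof (cases "i \<in> S")
    case True
    \<comment> \<open>compare with row \<open>i\<close> of the kernel equation multiplied by \<open>sgn (u i)\<close>; equality holds for \<open>k = i\<close>\<close>
    have "A $$ (i, k) * \<bar>u k\<bar> \<le> sgn (u i) * (A $$ (i, k) * u k)" if k: "k \<in> S" for k
    proof (cases "k = i")
      case True
      then show ?thesis by (simp add: abs_sgn mult_ac)
    next
      case False
      have "sgn (u i) * u k \<le> \<bar>u k\<bar>"
        by (simp add: sgn_if abs_if)
      then have "A $$ (i, k) * \<bar>u k\<bar> \<le> A $$ (i, k) * (sgn (u i) * u k)"
        using off[OF i, of k] k S_sub False by (intro mult_left_mono_neg) auto
      then show ?thesis by (simp add: mult_ac)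
    qed
    then have "(\<Sum>k\<in>S. A $$ (i, k) * \<bar>u k\<bar>) \<le> sgn (u i) * (\<Sum>k\<in>S. A $$ (i, k) * u k)"
      unfolding sum_distrib_left by (rule sum_mono)
    then show ?thesis
      using u(2)[OF True] restrict[of "\<lambda>k. \<bar>u k\<bar>"] by (simp add: w_def[abs_def])
  next
    case False
    then show ?thesis
      using outside[OF i, of "\<lambda>k. \<bar>u k\<bar>"] restrict[of "\<lambda>k. \<bar>u k\<bar>"] by (simp add: w_def[abs_def])
  qed
  obtain Q where Q: "Q \<in> carrier_mat n n" "Q * A = A * Q"
    "\<And>i j. i < n \<Longrightarrow> j < n \<Longrightarrow> Q $$ (i, j) \<ge> 0"
    "\<And>i j. i < n \<Longrightarrow> j < n \<Longrightarrow> Q $$ (i, j) > 0 \<longleftrightarrow> has_access A i j"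
    using access_pattern_matrix[OF A off] by blast
  define v where "v = mat_app Q w"
  have v_nn: "v i \<ge> 0" if "i < n" for i
    unfolding v_def by (rule mat_app_nonneg[OF Q(1) Q(3)[OF that] w_nn])
  have v_pos: "v i > 0 \<longleftrightarrow> (\<exists>k\<in>S. u k \<noteq> 0 \<and> has_access A i k)" if "i < n" for i
  proof -
    have "v i > 0 \<longleftrightarrow> (\<exists>k<n. Q $$ (i, k) > 0 \<and> w k > 0)"
      unfolding v_def by (rule mat_app_pos_iff[OF Q(1) Q(3)[OF that] w_nn])
    then show ?thesis
      using Q(4)[OF that] S_sub by (auto simp: w_def split: if_splits)
  qed
  have Av: "mat_app A v i \<le> 0" if "i < n" for i
  proof -
    have "mat_app A v i = mat_app Q (mat_app A w) i"
      using mat_app_mult[OF A Q(1) that, of w] mat_app_mult[OF Q(1) A that, of w] Q(2)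
      by (simp add: v_def)
    also have "\<dots> \<le> 0"
      by (rule mat_app_nonpos[OF Q(1) Q(3)[OF that] Aw])
    finally show ?thesis .
  qed
  show ?thesis
  proof
    show "(if i \<in> S then v i else 0) > 0" if "i \<in> S" for i
      using that v_pos[of i] u(1) S_sub access_class_access[OF cl] by auto
    show "(if i \<in> S then v i else 0) = 0" if "i \<notin> S" for i
      using that by simp
    fix i assume i: "i < n"
    show "mat_app A (\<lambda>i. if i \<in> S then v i else 0) i \<le> 0"
    proof (cases "i \<in> S")
      case True
      have "A $$ (i, k) * v k = A $$ (i, k) * (if k \<in> S then v k else 0)" if k: "k < n" for k
      proof (rule ccontr)
        assume "\<not> ?thesis"
        then have *: "k \<notin> S" "A $$ (i, k) \<noteq> 0" "v k > 0"
          using v_nn[OF k] by (auto split: if_splits)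
        then obtain s where "s \<in> S" "has_access A k s" using v_pos[OF k] by blast
        then have "has_access A k i"
          using access_class_access[OF cl _ True] has_access_trans by blast
        then show False
          using access_class_closed[OF cl True has_access_edge[OF A i k]] * by blast
      qed
      then have "mat_app A (\<lambda>i. if i \<in> S then v i else 0) i = mat_app A v i"
        using A unfolding mat_app_def by (intro sum.cong) (metis carrier_matD(2) lessThan_iff)+
      then show ?thesis using Av[OF i] by simp
    next
      case False
      then show ?thesis
        using outside[OF i False, of v] v_nn S_sub by (auto simp: restrict)
    qed
  qed
qed

lemma singular_class_test_vector:
  fixes A :: "real mat"
  assumes A: "A \<in> carrier_mat n n"
    and off: "\<And>i j. i < n \<Longrightarrow> j < n \<Longrightarrow> i \<noteq> j \<Longrightarrow> A $$ (i, j) \<le> 0"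
    and S: "S \<in> singular_classes A"
  shows "\<exists>x. \<forall>i<n. x i \<ge> 0 \<and> (x i > 0 \<longleftrightarrow> has_access_to_set A i S) \<and> mat_app A x i \<le> 0 \<and>
    (has_access_to_set A i S \<and> i \<notin> S \<longrightarrow> mat_app A x i < 0)"
proof -
  have cl: "S \<in> access_classes A"
    using S by (auto simp: singular_classes_def)
  have S_sub: "S \<subseteq> {..<n}"
    using access_class_less[OF cl] A by auto
  obtain y where y: "\<And>i. i \<in> S \<Longrightarrow> y i > 0" "\<And>i. i \<notin> S \<Longrightarrow> y i = 0"
    "\<And>i. i < n \<Longrightarrow> mat_app A y i \<le> 0"
    using singular_class_supported_vector[OF A off S] by blast
  have y_nn: "y i \<ge> 0" for i
    using y(1,2)[of i] by (cases "i \<in> S") auto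
  obtain Q where Q: "Q \<in> carrier_mat n n" "Q * A = A * Q"
    "\<And>i j. i < n \<Longrightarrow> j < n \<Longrightarrow> Q $$ (i, j) \<ge> 0"
    "\<And>i j. i < n \<Longrightarrow> j < n \<Longrightarrow> Q $$ (i, j) > 0 \<longleftrightarrow> has_access A i j"
    using access_pattern_matrix[OF A off] by blast
  define x where "x = mat_app Q y"
  have Ax: "mat_app A x i = mat_app Q (mat_app A y) i" if "i < n" for i
    using mat_app_mult[OF A Q(1) that, of y] mat_app_mult[OF Q(1) A that, of y] Q(2)
    by (simp add: x_def)
  show ?thesis
  proof (intro exI[of _ x] allI impI conjI; (elim conjE)?)
    fix i assume i: "i < n"
    show "x i \<ge> 0"
      unfolding x_def by (rule mat_app_nonneg[OF Q(1) Q(3)[OF i] y_nn])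
    have "x i > 0 \<longleftrightarrow> (\<exists>k<n. Q $$ (i, k) > 0 \<and> y k > 0)"
      unfolding x_def by (rule mat_app_pos_iff[OF Q(1) Q(3)[OF i] y_nn])
    moreover have "y k > 0 \<longleftrightarrow> k \<in> S" for k
      using y(1,2)[of k] by (cases "k \<in> S") auto
    ultimately show "x i > 0 \<longleftrightarrow> has_access_to_set A i S"
      using Q(4)[OF i] S_sub by (auto simp: has_access_to_set_def)
    show "mat_app A x i \<le> 0"
      unfolding Ax[OF i] by (rule mat_app_nonpos[OF Q(1) Q(3)[OF i] y(3)])
  next
    fix i assume i: "i < n" "has_access_to_set A i S" "i \<notin> S"
    then obtain s where s: "s \<in> S" "(i, s) \<in> (graph_edges A)\<^sup>*"
      by (auto simp: has_access_to_set_def has_access_def)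
    \<comment> \<open>the last vertex outside \<open>S\<close> on a path from \<open>i\<close> into \<open>S\<close>\<close>
    have "\<exists>k s'. (i, k) \<in> (graph_edges A)\<^sup>* \<and> (k, s') \<in> graph_edges A \<and> k \<notin> S \<and> s' \<in> S"
      using s(2,1) i(3) by (induction rule: rtrancl_induct) blast+
    then obtain k s' where k: "(i, k) \<in> (graph_edges A)\<^sup>*" "(k, s') \<in> graph_edges A" "k \<notin> S" "s' \<in> S"
      by blast
    then have kn: "k < n" "s' < n" "A $$ (k, s') \<noteq> 0"
      using A by (auto simp: graph_edges_def)
    have "A $$ (k, s') < 0"
      using off[of k s'] kn k by (metis less_le)
    then have "0 < (\<Sum>j<n. - (A $$ (k, j) * y j))"
    proof (intro sum_pos2[where i = s'])
      fix j assume "j \<in> {..<n}"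
      then show "0 \<le> - (A $$ (k, j) * y j)"
        using off[of k j] kn y_nn[of j] y(2)[OF k(3)] by (cases "j = k") (auto simp: mult_nonpos_nonneg)
    qed (use kn y(1)[OF k(4)] in \<open>auto simp: mult_neg_pos\<close>)
    then have Ay: "mat_app A y k < 0"
      using A by (simp add: mat_app_def sum_negf)
    have Q_pos: "Q $$ (i, k) > 0"
      using Q(4) i(1) kn k(1) A by (simp add: has_access_def)
    show "mat_app A x i < 0"
      unfolding Ax[OF i(1)] by (rule mat_app_neg[where k = k and x = "mat_app A y", OF Q(1) Q(3)[OF i(1)] y(3) kn(1) Q_pos Ay])
  qed
qed

section \<open>Access to singular classes\<close>

lemma m_matrix_entries:
  assumes "m_matrix M" "M \<in> carrier_mat n n"
  shows "\<exists>P \<alpha>. P \<in> carrier_mat n n \<and> (\<forall>i<n. \<forall>j<n. P $$ (i, j) \<ge> 0) \<and>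
    spectral_radius (map_mat complex_of_real P) \<le> \<alpha> \<and>
    (\<forall>i<n. \<forall>j<n. M $$ (i, j) = (if i = j then \<alpha> else 0) - P $$ (i, j))"
proof -
  from assms(1) obtain m P \<alpha> where P: "P \<in> carrier_mat m m" "0\<^sub>m m m \<le> P"
    "spectral_radius (map_mat complex_of_real P) \<le> \<alpha>" "M = \<alpha> \<cdot>\<^sub>m 1\<^sub>m m - P"
    by (auto simp: m_matrix_def)
  have "m = n" using assms(2) P(1,4) by auto
  with P show ?thesis
    by (intro exI[of _ P] exI[of _ \<alpha>]) (auto simp: less_eq_mat_def)
qed

lemma m_matrix_off_diagonal:
  assumes "m_matrix M" "M \<in> carrier_mat n n" "i < n" "j < n" "i \<noteq> j"
  shows "M $$ (i, j) \<le> 0"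
proof -
  from m_matrix_entries[OF assms(1,2)] obtain P \<alpha> where
    "(\<forall>i<n. \<forall>j<n. P $$ (i, j) \<ge> 0) \<and>
      (\<forall>i<n. \<forall>j<n. M $$ (i, j) = (if i = j then \<alpha> else 0) - P $$ (i, j))"
    by (elim exE conjE) (rule that, rule conjI)
  then show ?thesis
    using assms(3-5) by simp
qed

text \<open>
  Strict negativity of \<open>A x\<close> passes to \<open>B A x\<close>: a class of \<open>A\<close> that contains a vertex outside \<open>S\<close> with
  access to \<open>S\<close> consists of such vertices, and each row of \<open>B\<close> has a positive entry within the class of its index.
\<close>

lemma class_nonsingular_product_neg:
  fixes A B :: "real mat"
  assumes A: "A \<in> carrier_mat n n" and B: "B \<in> N_set A" and S: "S \<in> access_classes A"
    and nonpos: "\<And>i. i < n \<Longrightarrow> mat_app A x i \<le> 0"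
    and neg: "\<And>i. i < n \<Longrightarrow> has_access_to_set A i S \<Longrightarrow> i \<notin> S \<Longrightarrow> mat_app A x i < 0"
    and i: "i < n" "has_access_to_set A i S" "i \<notin> S"
  shows "mat_app (B * A) x i < 0"
proof -
  from A have dim: "dim_row A = n" by (rule carrier_matD(1))
  have Bc: "B \<in> carrier_mat n n" and B_le: "0\<^sub>m n n \<le> B" and "class_nonsingular A B"
    using B unfolding N_set_def dim by blast+
  then have B_inv: "invertible_mat (submatrix B K K)" if "K \<in> access_classes A" for K
    using that unfolding class_nonsingular_def by blast
  have B_nn: "B $$ (i, j) \<ge> 0" if "i < n" "j < n" for i j
    using B_le Bc that by (auto simp: less_eq_mat_def)
  obtain K where K: "K \<in> access_classes A" "i \<in> K"
    using access_class_ex[of i A] carrier_matD(1)[OF A] i(1) by auto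
  have K_sub: "K \<subseteq> {..<n}"
    using access_class_less[OF K(1)] A by auto
  obtain k where k: "k \<in> K" "B $$ (i, k) \<noteq> 0"
    using invertible_submatrix_row_nonzero[OF Bc K_sub B_inv[OF K(1)] K(2)] by blast
  have kn: "k < n" using k K_sub by auto
  have ik: "has_access A i k" "has_access A k i"
    using access_class_access[OF K(1)] K(2) k(1) by blast+
  have "has_access_to_set A k S"
    using i(2) has_access_trans[OF ik(2)] by (auto simp: has_access_to_set_def)
  moreover have "k \<notin> S"
    using access_class_closed[OF S _ ik(2,1)] i(3) by blast
  ultimately have Ax: "mat_app A x k < 0" using neg kn by blast
  have Bik: "B $$ (i, k) > 0" using k(2) B_nn[OF i(1) kn] by simp
  have "mat_app B (mat_app A x) i < 0"
    by (rule mat_app_neg[where k = k and x = "mat_app A x", OF Bc B_nn[OF i(1)] nonpos kn Bik Ax])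
  then show ?thesis
    by (simp only: mat_app_mult[OF Bc A i(1)])
qed

theorem theorem4p1:
  fixes A U :: "real mat" and n j :: nat and S :: "nat set"
  assumes "A \<in> carrier_mat n n"
    and "m_matrix A"
    and "U \<in> U_set A"
    and "S \<in> singular_classes A"
    and "j < n"
    and "has_access_to_set A j S"
  shows "\<exists>q\<in>S. has_access U j q"
proof (rule ccontr)
  note A = assms(1)
  assume contra: "\<not> ?thesis"
  have cl: "S \<in> access_classes A"
    using assms(4) by (auto simp: singular_classes_def)
  have off: "A $$ (i, k) \<le> 0" if "i < n" "k < n" "i \<noteq> k" for i k
    by (rule m_matrix_off_diagonal[OF assms(2) A that])
  obtain B where B: "B \<in> N_set A" "U = B * A" "m_matrix U"
    using assms(3) unfolding U_set_def by blast
  have "B \<in> carrier_mat n n"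
    using B(1) unfolding N_set_def carrier_matD(1)[OF A] by blast
  then have U: "U \<in> carrier_mat n n"
    unfolding B(2) using A by (rule mult_carrier_mat)
  from singular_class_test_vector[OF A off assms(4)] obtain x where
    x_all: "\<forall>i<n. x i \<ge> 0 \<and> (x i > 0 \<longleftrightarrow> has_access_to_set A i S) \<and> mat_app A x i \<le> 0 \<and>
      (has_access_to_set A i S \<and> i \<notin> S \<longrightarrow> mat_app A x i < 0)"
    by (rule exE)
  have x: "x i \<ge> 0" "x i > 0 \<longleftrightarrow> has_access_to_set A i S" "mat_app A x i \<le> 0"
    "has_access_to_set A i S \<Longrightarrow> i \<notin> S \<Longrightarrow> mat_app A x i < 0" if "i < n" for i
    using x_all that by blast+
  from m_matrix_entries[OF B(3) U]
  obtain P \<alpha> where P: "P \<in> carrier_mat n n" "\<forall>i<n. \<forall>k<n. P $$ (i, k) \<ge> 0"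
    "spectral_radius (map_mat complex_of_real P) \<le> \<alpha>"
    "\<forall>i<n. \<forall>k<n. U $$ (i, k) = (if i = k then \<alpha> else 0) - P $$ (i, k)"
    by (elim exE conjE)
  have U_app: "mat_app U z i = \<alpha> * z i - mat_app P z i" if "i < n" for z i
  proof -
    have "mat_app U z i = (\<Sum>k<n. (if i = k then \<alpha> * z k else 0) - P $$ (i, k) * z k)"
      using U that by (auto simp: mat_app_def P(4) left_diff_distrib intro!: sum.cong)
    then show ?thesis
      using P(1) that by (simp add: mat_app_def sum_subtractf)
  qed
  \<comment> \<open>no edge of \<open>U\<close> leads from the vertices where \<open>x'\<close> keeps the value of \<open>x\<close> to the others\<close>
  define x' where "x' i = (if has_access_to_set U i S then 0 else x i)" for i
  have "\<alpha> < spectral_radius (map_mat complex_of_real P)"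
  proof (rule spectral_radius_greaterI[OF P(1), of x' j])
    show "P $$ (i, k) \<ge> 0" if "i < n" "k < n" for i k
      using P(2) that by blast
    show "x' i \<ge> 0" if "i < n" for i
      using x(1)[OF that] by (simp add: x'_def)
    show "j < n" by (rule assms(5))
    show "x' j > 0"
      using contra assms(5,6) x(2) by (auto simp: x'_def has_access_to_set_def)
  next
    fix i assume i: "i < n" "x' i > 0"
    then have noacc: "\<not> has_access_to_set U i S" and "x i > 0"
      by (auto simp: x'_def split: if_splits)
    then have acc: "has_access_to_set A i S" using x(2) i(1) by blast
    have i_S: "i \<notin> S"
      using noacc has_access_refl[of i U] carrier_matD(1)[OF U] i(1) unfolding has_access_to_set_def by blast
    have neg: "mat_app U x i < 0"
      unfolding B(2) by (rule class_nonsingular_product_neg[OF A B(1) cl x(3) x(4) i(1) acc i_S])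
    have "U $$ (i, k) * x' k = U $$ (i, k) * x k" if "k < n" for k
    proof -
      have "U $$ (i, k) = 0" if "has_access_to_set U k S"
      proof (rule ccontr)
        assume "U $$ (i, k) \<noteq> 0"
        then have "has_access U i k" by (rule has_access_edge[OF U i(1) \<open>k < n\<close>])
        from has_access_trans[OF this] that noacc show False
          unfolding has_access_to_set_def by blast
      qed
      then show ?thesis by (auto simp: x'_def)
    qed
    then have "mat_app U x' i = mat_app U x i"
      using U unfolding mat_app_def by (intro sum.cong) auto
    with neg show "\<alpha> * x' i < mat_app P x' i"
      using U_app[OF i(1), of x'] by simp
  qed
  with P(3) show False by simp
qed

end
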